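(* Let $\mathcal P_d=(P,R,f)$ be a DPS instance such that (1) for every $e\in R$, $f_e$ is a power of two, and (2) for every $v\in P$, $\sum_{e\in R:\,v\in e}\frac1{f_e}\le\frac12$. Then there exists a valid schedule for $\mathcal P_d$.
   Context: A DPS instance $(P,R,f)$ consists of a finite simple undirected graph $(P,R)$ with integer frequencies $f:R\to\mathbb N$, $f_e=f(e)$. A schedule $S:\mathbb N_0\to2^R$ is valid if each $S(t)$ is a matching of $(P,R)$ and for every $e\in R$ the recurrence time $r_S(e)\le f_e$, where $r_S(e)$ is the supremum of $d+1$ over $d\in\mathbb N$ such that $e\notin S(t)\cup\dots\cup S(t+d-1)$ for some $t\in\mathbb N_0$ (and $1$ if there is no such $d$); i.e. every window of $f_e$ consecutive days contains a day on which $e$ is scheduled. *)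

theory Defs
  imports Complex_Main "HOL-Library.Extended_Nat"
begin

locale fin_simple_graph =
  fixes P :: "'a set" and R :: "'a set set"
  assumes finite_vertices: "finite P"
    and edges: "e \<in> R \<Longrightarrow> e \<subseteq> P \<and> card e = 2"

(* The convention is that \<nat> excludes 0 (as opposed to \<nat>\<^sub>0), so frequencies are positive; values of f outside R are irrelevant. *)
locale dps_instance = fin_simple_graph P R
  for P :: "'a set" and R :: "'a set set" +
  fixes f :: "'a set \<Rightarrow> nat"
  assumes frequency_pos: "e \<in> R \<Longrightarrow> f e \<ge> 1"

definition is_matching :: "'a set set \<Rightarrow> 'a set set \<Rightarrow> bool" where
  "is_matching R M \<longleftrightarrow> M \<subseteq> R \<and> pairwise disjnt M"

definition gap_lengths :: "(nat \<Rightarrow> 'e set) \<Rightarrow> 'e \<Rightarrow> nat set" where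
  "gap_lengths S e = {d. d \<ge> 1 \<and> (\<exists>t. e \<notin> (\<Union>s\<in>{t..<t + d}. S s))}"

(* Valued in enat because the supremum is infinite if e has arbitrarily long gaps. *)
definition recurrence_time :: "(nat \<Rightarrow> 'e set) \<Rightarrow> 'e \<Rightarrow> enat" where
  "recurrence_time S e =
     (if gap_lengths S e = {} then 1 else (SUP d\<in>gap_lengths S e. enat (d + 1)))"

definition valid_schedule ::
    "'a set set \<Rightarrow> ('a set \<Rightarrow> nat) \<Rightarrow> (nat \<Rightarrow> 'a set set) \<Rightarrow> bool" where
  "valid_schedule R f S \<longleftrightarrow>
     (\<forall>t. is_matching R (S t)) \<and> (\<forall>e\<in>R. recurrence_time S e \<le> enat (f e))"

lemma recurrence_time_le_iff:
  assumes "n \<ge> 1"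
  shows "recurrence_time S e \<le> enat n \<longleftrightarrow> (\<forall>t. \<exists>s\<in>{t..<t + n}. e \<in> S s)"
proof -
  have "recurrence_time S e \<le> enat n \<longleftrightarrow> (\<forall>d\<in>gap_lengths S e. d < n)"
    using assms by (auto simp: recurrence_time_def SUP_le_iff one_enat_def Suc_le_eq)
  also have "\<dots> \<longleftrightarrow> (\<forall>t. \<exists>s\<in>{t..<t + n}. e \<in> S s)"
  proof (intro iffI allI ballI)
    fix t assume *: "\<forall>d\<in>gap_lengths S e. d < n"
    then have "n \<notin> gap_lengths S e" by blast
    with assms show "\<exists>s\<in>{t..<t + n}. e \<in> S s" by (auto simp: gap_lengths_def)
  next
    fix d assume *: "\<forall>t. \<exists>s\<in>{t..<t + n}. e \<in> S s" and "d \<in> gap_lengths S e"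
    then obtain t where t: "\<forall>s\<in>{t..<t + d}. e \<notin> S s"
      by (auto simp: gap_lengths_def)
    from * obtain s where s: "s \<in> {t..<t + n}" "e \<in> S s" by blast
    show "d < n"
    proof (rule ccontr)
      assume "\<not> d < n"
      with s(1) have "s \<in> {t..<t + d}" by simp
      with t s(2) show False by blast
    qed
  qed
  finally show ?thesis .
qed

end

theory Submission
  imports Defs
begin

text \<open>
  Each edge e is scheduled exactly on the days of one residue class modulo f e, and the classes are
  chosen greedily in order of increasing frequency. When the edge e = uv is treated, an
  adjacent edge e' treated earlier has f e' dividing f e, so it blocks only f e / f e' of the
  residues modulo f e. By the density bound each endpoint of e accounts for at most
  f e / 2 - 1 blocked residues, so at least two residues remain free.
\<close>

text \<open>A member \<open>r\<close> of the class is determined by its quotient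
  \<open>r div m\<close>, which is below \<open>n div m\<close> because \<open>m\<close> divides
  \<open>n\<close>. Only an upper bound holds, as the class is empty for
  \<open>c \<ge> m > 0\<close>.\<close>

lemma card_residue_class_le:
  fixes m n c :: nat
  assumes "m dvd n"
  shows "card {r. r < n \<and> r mod m = c} \<le> n div m"
proof -
  have "{r. r < n \<and> r mod m = c} \<subseteq> (\<lambda>q. q * m + c) ` {..<n div m}"
  proof
    fix r assume r: "r \<in> {r. r < n \<and> r mod m = c}"
    then have "r = (r div m) * m + c" by auto
    moreover have "r div m < n div m"
      using r assms by (intro less_mult_imp_div_less) simp
    ultimately show "r \<in> (\<lambda>q. q * m + c) ` {..<n div m}" by blast
  qed
  then have "card {r. r < n \<and> r mod m = c} \<le> card ((\<lambda>q. q * m + c) ` {..<n div m})"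
    by (intro card_mono) auto
  also have "\<dots> \<le> n div m"
    using card_image_le[of "{..<n div m}" "\<lambda>q. q * m + c"] by simp
  finally show ?thesis .
qed

lemma ex_residue_in_window:
  fixes c n t :: nat
  assumes "c < n"
  shows "\<exists>s\<in>{t..<t + n}. s mod n = c"
proof -
  \<comment> \<open>The offset from \<open>t\<close> is \<open>c - t\<close> reduced modulo
    \<open>n\<close>; writing \<open>n - t mod n\<close> keeps the subtraction on naturals
    exact.\<close>
  have "(t + (c + (n - t mod n)) mod n) mod n = (t mod n + (c + (n - t mod n))) mod n"
    by (simp add: mod_simps)
  also have "t mod n + (c + (n - t mod n)) = c + n"
    using assms mod_less_divisor[of n t] by linarith
  finally have "(t + (c + (n - t mod n)) mod n) mod n = c"
    using assms by simp
  moreover have "t + (c + (n - t mod n)) mod n \<in> {t..<t + n}"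
    using assms by simp
  ultimately show ?thesis by blast
qed

lemma ex_free_residue:
  fixes f a :: "'a set \<Rightarrow> nat"
  assumes "finite F" "card x = 2" "x \<notin> F" "f x \<ge> 1"
    and dvd: "\<And>e. e \<in> F \<Longrightarrow> f e dvd f x"
    and density: "\<And>v. v \<in> x \<Longrightarrow> (\<Sum>e | e \<in> insert x F \<and> v \<in> e. 1 / real (f e)) \<le> 1 / 2"
  obtains r where "r < f x" "\<And>e. e \<in> F \<Longrightarrow> \<not> disjnt e x \<Longrightarrow> r mod f e \<noteq> a e"
proof -
  \<comment> \<open>\<open>B v\<close> collects the residues modulo \<open>f x\<close> that are
    blocked by edges of \<open>F\<close> at the endpoint \<open>v\<close>.\<close>
  define B where "B v = (\<Union>e\<in>{e \<in> F. v \<in> e}. {r. r < f x \<and> r mod f e = a e})" for v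
  have card_B: "real (card (B v)) \<le> real (f x) / 2 - 1" if "v \<in> x" for v
  proof -
    have "card (B v) \<le> (\<Sum>e | e \<in> F \<and> v \<in> e. card {r. r < f x \<and> r mod f e = a e})"
      unfolding B_def using assms(1) by (intro card_UN_le) simp
    also have "\<dots> \<le> (\<Sum>e | e \<in> F \<and> v \<in> e. f x div f e)"
      by (intro sum_mono card_residue_class_le dvd) simp
    finally have "real (card (B v)) \<le> real (\<Sum>e | e \<in> F \<and> v \<in> e. f x div f e)"
      by (rule of_nat_mono)
    \<comment> \<open>By divisibility the integer quotients are exact, so the count becomes a
      density.\<close>
    also have "\<dots> = real (f x) * (\<Sum>e | e \<in> F \<and> v \<in> e. 1 / real (f e))"
      by (simp add: sum_distrib_left real_of_nat_div dvd)
    \<comment> \<open>The edge \<open>x\<close> itself uses \<open>1 / f x\<close> of the density at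
      \<open>v\<close>; multiplied by \<open>f x\<close>, this share is the \<open>- 1\<close> in
      the bound.\<close>
    also have "(\<Sum>e | e \<in> F \<and> v \<in> e. 1 / real (f e)) \<le> 1 / 2 - 1 / real (f x)"
    proof -
      have "{e. e \<in> insert x F \<and> v \<in> e} = insert x {e. e \<in> F \<and> v \<in> e}"
        using that by auto
      then show ?thesis using density[OF that] assms(1,3) by simp
    qed
    finally show ?thesis
      using assms(4) by (simp add: mult_left_mono right_diff_distrib)
  qed
  have fin: "finite x" using assms(2) card_gt_0_iff by fastforce
  have "real (card (\<Union>v\<in>x. B v)) \<le> (\<Sum>v\<in>x. real (card (B v)))"
    using card_UN_le[OF fin, of B] by (metis of_nat_mono of_nat_sum)
  also have "\<dots> \<le> (\<Sum>v\<in>x. real (f x) / 2 - 1)"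
    by (intro sum_mono card_B)
  also have "\<dots> < real (f x)"
    using assms(2) by simp
  finally have "card (\<Union>v\<in>x. B v) < card {..<f x}" by simp
  moreover have "finite (\<Union>v\<in>x. B v)"
    using fin assms(1) by (auto simp: B_def)
  ultimately have "\<not> {..<f x} \<subseteq> (\<Union>v\<in>x. B v)"
    using card_mono leD by blast
  then obtain r where "r < f x" "r \<notin> (\<Union>v\<in>x. B v)" by auto
  then show thesis
    by (intro that[of r]) (auto simp: B_def disjnt_iff)
qed

text \<open>Induction along increasing \<open>f\<close>: each new edge has maximal frequency so far,
  so all earlier frequencies divide it. Powers of two enter only through this divisibility chain.
  Density is stated on \<open>\<Union>R\<close> so that it passes to subsets of the edges.\<close>

lemma ex_residue_assignment:
  fixes f :: "'a set \<Rightarrow> nat"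
  assumes "finite R" and "\<And>e. e \<in> R \<Longrightarrow> card e = 2" and pos: "\<And>e. e \<in> R \<Longrightarrow> f e \<ge> 1"
    and dvd: "\<And>e e'. e \<in> R \<Longrightarrow> e' \<in> R \<Longrightarrow> f e \<le> f e' \<Longrightarrow> f e dvd f e'"
    and density: "\<And>v. v \<in> \<Union>R \<Longrightarrow> (\<Sum>e | e \<in> R \<and> v \<in> e. 1 / real (f e)) \<le> 1 / 2"
  shows "\<exists>a. (\<forall>e\<in>R. a e < f e) \<and>
    (\<forall>t. pairwise disjnt {e \<in> R. t mod f e = a e})"
  using assms
proof (induction R rule: finite_ranking_induct[where f = f])
  case empty
  then show ?case by simp
next
  case (insert x F)
  show ?case
  \<comment> \<open>If \<open>x\<close> already lies in \<open>F\<close>, the insertion changes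
    nothing; a free residue is sought only for a new edge.\<close>
  proof (cases "x \<in> F")
    case True
    then show ?thesis using insert by (simp add: insert_absorb)
  next
    case False
    have "(\<Sum>e | e \<in> F \<and> v \<in> e. 1 / real (f e)) \<le> 1 / 2" if "v \<in> \<Union>F" for v
    proof -
      have "(\<Sum>e | e \<in> F \<and> v \<in> e. 1 / real (f e)) \<le>
          (\<Sum>e | e \<in> insert x F \<and> v \<in> e. 1 / real (f e))"
        using insert.hyps(1) by (intro sum_mono2) auto
      also have "\<dots> \<le> 1 / 2" using insert.prems(4) that by blast
      finally show ?thesis .
    qed
    then have "\<exists>a. (\<forall>e\<in>F. a e < f e) \<and>
        (\<forall>t. pairwise disjnt {e \<in> F. t mod f e = a e})"
      using insert.prems(1-3) by (intro insert.IH) simp_all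
    then obtain a where a: "\<And>e. e \<in> F \<Longrightarrow> a e < f e"
      and disj: "\<And>t. pairwise disjnt {e \<in> F. t mod f e = a e}"
      by blast
    have dvd: "f e dvd f x" if "e \<in> F" for e
      using insert.prems(3) insert.hyps(2) that by blast
    have density_x: "(\<Sum>e | e \<in> insert x F \<and> v \<in> e. 1 / real (f e)) \<le> 1 / 2" if "v \<in> x" for v
      using insert.prems(4) that by blast
    obtain r where r: "r < f x" "\<And>e. e \<in> F \<Longrightarrow> \<not> disjnt e x \<Longrightarrow> r mod f e \<noteq> a e"
      using ex_free_residue[of F x f a] insert.hyps(1) insert.prems(1,2) False dvd density_x
      by blast
    \<comment> \<open>Since \<open>f e\<close> divides \<open>f x\<close>, a day congruent to
      \<open>r\<close> modulo \<open>f x\<close> is congruent to \<open>r\<close> modulo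
      \<open>f e\<close>. An adjacent \<open>e\<close> on the same day would thus force
      \<open>r mod f e = a e\<close>.\<close>
    have x_disj: "disjnt e x" if "e \<in> F" "t mod f x = r" "t mod f e = a e" for e t
      using r(2)[OF that(1)] mod_mod_cancel[OF dvd[OF that(1)], of t] that by auto
    have "pairwise disjnt {e \<in> insert x F. t mod f e = (a(x := r)) e}" for t
      using disj[of t] x_disj[of _ t] False
      by (auto simp: pairwise_def disjnt_sym)
    then show ?thesis using a r(1) by (intro exI[of _ "a(x := r)"]) auto
  qed
qed

theorem theorem10:
  fixes P :: "'a set" and R :: "'a set set" and f :: "'a set \<Rightarrow> nat"
  assumes "dps_instance P R f"
    and "\<forall>e\<in>R. \<exists>k::nat. f e = 2 ^ k"
    and "\<forall>v\<in>P. (\<Sum>e\<in>{e\<in>R. v \<in> e}. 1 / real (f e)) \<le> 1 / 2"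
  shows "\<exists>S. valid_schedule R f S"
proof -
  interpret dps_instance P R f by fact
  have "R \<subseteq> Pow P" using edges by blast
  then have "finite R" using finite_vertices finite_subset by blast
  moreover have "f e dvd f e'" if "e \<in> R" "e' \<in> R" "f e \<le> f e'" for e e'
  proof -
    from assms(2) that(1,2) obtain k l where "f e = 2 ^ k" "f e' = 2 ^ l" by blast
    with that(3) show ?thesis by (simp add: le_imp_power_dvd)
  qed
  moreover have "(\<Sum>e | e \<in> R \<and> v \<in> e. 1 / real (f e)) \<le> 1 / 2" if "v \<in> \<Union>R" for v
    using assms(3) \<open>R \<subseteq> Pow P\<close> that by blast
  ultimately obtain a where a: "\<forall>e\<in>R. a e < f e"
    and disj: "\<forall>t. pairwise disjnt {e \<in> R. t mod f e = a e}"
    using ex_residue_assignment[of R f] edges frequency_pos by blast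
  \<comment> \<open>Any window of \<open>f e\<close> consecutive days meets every residue class
    modulo \<open>f e\<close>, which gives the recurrence bound.\<close>
  have "valid_schedule R f (\<lambda>t. {e \<in> R. t mod f e = a e})"
    unfolding valid_schedule_def is_matching_def
    using disj a ex_residue_in_window by (auto simp: recurrence_time_le_iff frequency_pos)
  then show ?thesis by blast
qed

end
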